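(* Let $R$ be a finite commutative ring with identity and let $J(R)$ be the Jacobson radical of $R$. For any $x,y\in R$, if $x$ is adjacent to $y$ in the unit-zero divisor graph $G_{UZ}(R)$, then $x+J(R)$ is adjacent to $y+J(R)$ in $G_{UZ}(R/J(R))$.
   Context: For a finite commutative ring $S$ with identity, $U(S)$ is the set of units and $Z(S)$ is the set of zero divisors, with the convention $0\in Z(S)$. The unit-zero divisor graph $G_{UZ}(S)$ is the simple undirected graph whose vertex set is the set of all elements of $S$, where two distinct vertices $u,v$ are adjacent if and only if $u+v\in U(S)$ and $uv\in Z(S)$. The Jacobson radical $J(R)$ is the intersection of all maximal ideals of $R$. *)

theory Defs
  imports
    "HOL-Algebra.QuotRing"
    "Graph_Theory.Pair_Digraph"
begin

text \<open>
  The intersection of all maximal ideals. Intersecting with the carrier only matters for the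
  zero ring: it has no maximal ideals, and the empty intersection is the whole ring.
\<close>
definition jacobson_radical :: "('a, 'm) ring_scheme \<Rightarrow> 'a set" where
  "jacobson_radical R = carrier R \<inter> \<Inter> {I. maximalideal I R}"

text \<open>Zero is included by convention; in a nonzero ring it also satisfies the second condition.\<close>
definition zero_divisors :: "('a, 'm) ring_scheme \<Rightarrow> 'a set" where
  "zero_divisors R = insert \<zero>\<^bsub>R\<^esub>
     {a \<in> carrier R. \<exists>b \<in> carrier R. b \<noteq> \<zero>\<^bsub>R\<^esub> \<and> a \<otimes>\<^bsub>R\<^esub> b = \<zero>\<^bsub>R\<^esub>}"

text \<open>
  Simple undirected graphs are loop-free symmetric digraphs here, so an edge
  between \<open>u\<close> and \<open>v\<close> is the pair of arcs \<open>(u, v)\<close> and \<open>(v, u)\<close>.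
\<close>
definition unit_zero_divisor_graph :: "('a, 'm) ring_scheme \<Rightarrow> 'a pair_pre_digraph" where
  "unit_zero_divisor_graph R =
     \<lparr> pverts = carrier R,
       parcs = {(u, v). u \<in> carrier R \<and> v \<in> carrier R \<and> u \<noteq> v \<and>
                  u \<oplus>\<^bsub>R\<^esub> v \<in> Units R \<and> u \<otimes>\<^bsub>R\<^esub> v \<in> zero_divisors R} \<rparr>"

lemma pair_graph_unit_zero_divisor_graph:
  assumes "cring R" and fin: "finite (carrier R)"
  shows "pair_graph (unit_zero_divisor_graph R)"
proof -
  interpret cring R by fact
  let ?G = "unit_zero_divisor_graph R"
  have "parcs ?G \<subseteq> carrier R \<times> carrier R"
    by (auto simp: unit_zero_divisor_graph_def)
  then have "finite (parcs ?G)"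
    using fin by (meson finite_SigmaI finite_subset)
  moreover have "symmetric ?G"
    unfolding symmetric_def sym_def
    by (auto simp: unit_zero_divisor_graph_def a_comm m_comm)
  ultimately show ?thesis
    using fin by unfold_locales (auto simp: unit_zero_divisor_graph_def)
qed

lemma ideal_jacobson_radical:
  assumes "cring R"
  shows "ideal (jacobson_radical R) R"
proof -
  interpret cring R by fact
  have "jacobson_radical R = \<Inter> (insert (carrier R) {I. maximalideal I R})"
    by (auto simp: jacobson_radical_def)
  also have "ideal \<dots> R"
    by (rule i_Intersect) (auto intro: oneideal maximalideal.axioms)
  finally show ?thesis .
qed

end

theory Submission
  imports Defs
begin

text \<open>
  Finiteness makes non-units and zero divisors coincide, both in \<open>R\<close> and in \<open>R/J\<close>. So \<open>x y\<close> lies in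
  a maximal ideal \<open>M\<close>, which contains \<open>J\<close>; hence \<open>x y\<close> is a non-unit also modulo \<open>J\<close>. The two cosets
  are distinct: one of \<open>x\<close>, \<open>y\<close> is in \<open>M\<close>, so if \<open>x - y \<in> J\<close> then both are, and then so is the
  unit \<open>x + y\<close>.
\<close>

text \<open>In the zero ring \<open>\<zero>\<close> is both a unit and a zero divisor, hence the
  first assumption. Otherwise a unit can be cancelled from
  \<open>a \<otimes> b = a \<otimes> \<zero>\<close>.\<close>

lemma (in cring) zero_divisors_not_Units:
  assumes "\<one> \<noteq> \<zero>" and a: "a \<in> zero_divisors R"
  shows "a \<notin> Units R"
proof
  assume u: "a \<in> Units R"
  \<comment> \<open>If \<open>a\<close> is the zero inserted by convention, \<open>\<one>\<close>
    serves as \<open>b\<close>.\<close>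
  have "\<exists>b \<in> carrier R. b \<noteq> \<zero> \<and> a \<otimes> b = \<zero>"
    using a assms(1) l_null[OF one_closed] by (auto simp: zero_divisors_def)
  then obtain b where b: "b \<in> carrier R" "b \<noteq> \<zero>" "a \<otimes> b = \<zero>"
    by blast
  have "a \<otimes> b = a \<otimes> \<zero>"
    using b u by (simp add: Units_closed)
  then show False
    using Units_l_cancel[OF u b(1) zero_closed] b(2) by simp
qed

text \<open>By contraposition: multiplication by an element that is not a zero divisor is injective,
  hence surjective on a finite carrier, so it attains \<open>\<one>\<close>.\<close>

lemma (in cring) finite_not_Units_zero_divisors:
  assumes fin: "finite (carrier R)" and a: "a \<in> carrier R" "a \<notin> Units R"
  shows "a \<in> zero_divisors R"
proof (rule ccontr)
  assume nz: "a \<notin> zero_divisors R"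
  have "inj_on (\<lambda>b. a \<otimes> b) (carrier R)"
  proof (rule inj_onI)
    fix b c
    assume bc: "b \<in> carrier R" "c \<in> carrier R" "a \<otimes> b = a \<otimes> c"
    then have "a \<otimes> (b \<ominus> c) = \<zero>"
      using a by (simp add: minus_eq r_distr r_minus r_neg)
    then have "b \<ominus> c = \<zero>"
      using nz a bc by (auto simp: zero_divisors_def)
    moreover have "b = (b \<ominus> c) \<oplus> c"
      using bc by algebra
    ultimately show "b = c"
      using bc(2) by simp
  qed
  then have "(\<lambda>b. a \<otimes> b) ` carrier R = carrier R"
    using fin a by (intro endo_inj_surj) auto
  then obtain b where "b \<in> carrier R" "a \<otimes> b = \<one>"
    by (metis imageE one_closed)
  then have "a \<in> Units R"
    using a(1) m_comm[OF a(1)] unfolding Units_def by fastforce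
  with a(2) show False by simp
qed

text \<open>Finiteness takes the place of Zorn's lemma: the proper ideals containing
  \<open>a\<close> form a finite set, nonempty because \<open>PIdl a\<close> is proper for a
  non-unit. An inclusion-maximal member is a maximal ideal, since every ideal above it still
  contains \<open>a\<close>.\<close>

lemma (in cring) finite_not_Units_maximalideal:
  assumes fin: "finite (carrier R)" and a: "a \<in> carrier R" "a \<notin> Units R"
  obtains M where "maximalideal M R" "a \<in> M"
proof -
  let ?S = "{I. ideal I R \<and> a \<in> I \<and> I \<noteq> carrier R}"
  have "?S \<subseteq> Pow (carrier R)"
    by (auto dest: ideal.Icarr)
  then have "finite ?S"
    using fin by (meson finite_Pow_iff finite_subset)
  moreover have "\<one> \<notin> PIdl a"
  proof
    assume "\<one> \<in> PIdl a"
    then obtain b where "b \<in> carrier R" "b \<otimes> a = \<one>"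
      by (auto simp: cgenideal_def)
    then show False
      using a m_comm[OF a(1)] unfolding Units_def by fastforce
  qed
  then have "PIdl a \<in> ?S"
    using a(1) cgenideal_ideal cgenideal_self one_closed by blast
  ultimately obtain M where M: "M \<in> ?S" "\<And>I. I \<in> ?S \<Longrightarrow> M \<subseteq> I \<Longrightarrow> M = I"
    using finite_has_maximal2[of ?S "PIdl a"] by (metis (lifting))
  have "maximalideal M R"
  proof (rule maximalidealI)
    show "ideal M R" "carrier R \<noteq> M"
      using M(1) by auto
    show "I = M \<or> I = carrier R" if "ideal I R" "M \<subseteq> I" for I
      using M(1) M(2)[of I] that by blast
  qed
  with M(1) that show thesis by blast
qed

lemma jacobson_radical_subset_maximalideal:
  assumes "maximalideal M R"
  shows "jacobson_radical R \<subseteq> M"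
  using assms by (auto simp: jacobson_radical_def)

lemma (in ring_hom_ring) hom_Units:
  assumes "a \<in> Units R"
  shows "h a \<in> Units S"
proof -
  obtain b where "a \<in> carrier R" "b \<in> carrier R" "a \<otimes> b = \<one>" "b \<otimes> a = \<one>"
    using assms by (auto simp: Units_def)
  then have "h a \<otimes>\<^bsub>S\<^esub> h b = \<one>\<^bsub>S\<^esub>" "h b \<otimes>\<^bsub>S\<^esub> h a = \<one>\<^bsub>S\<^esub>" "h a \<in> carrier S" "h b \<in> carrier S"
    by (metis hom_mult hom_one, metis hom_mult hom_one, simp_all)
  then show ?thesis
    by (auto simp: Units_def)
qed

text \<open>If \<open>b\<close> represents the inverse coset, then
  \<open>a \<otimes> b \<ominus> \<one>\<close> lies in \<open>J\<close> and so in \<open>M\<close>.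
  With \<open>a \<in> M\<close>, subtracting it from \<open>a \<otimes> b\<close> would put
  \<open>\<one>\<close> into \<open>M\<close>. This carries non-units from \<open>R\<close> to the
  quotient.\<close>

lemma (in cring) rcos_Units_imp_not_mem_ideal:
  assumes "ideal J R" "ideal M R" "J \<subseteq> M" "M \<noteq> carrier R"
    and a: "a \<in> carrier R" and u: "J +> a \<in> Units (R Quot J)"
  shows "a \<notin> M"
proof
  assume aM: "a \<in> M"
  interpret J: ideal J R by fact
  interpret M: ideal M R by fact
  obtain b where b: "b \<in> carrier R" "(J +> a) \<otimes>\<^bsub>R Quot J\<^esub> (J +> b) = \<one>\<^bsub>R Quot J\<^esub>"
    using u by (auto simp: Units_def FactRing_def A_RCOSETS_def')
  then have "J +> (a \<otimes> b) = J +> \<one>"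
    using a by (simp add: FactRing_def J.rcoset_mult_add)
  then have "a \<otimes> b \<ominus> \<one> \<in> M"
    using quotient_eq_iff_same_a_r_cos[OF \<open>ideal J R\<close>, of "a \<otimes> b" \<one>] a b \<open>J \<subseteq> M\<close> by auto
  moreover have "a \<otimes> b \<in> M"
    using aM b(1) by (rule M.I_r_closed)
  ultimately have "a \<otimes> b \<oplus> \<ominus> (a \<otimes> b \<ominus> \<one>) \<in> M"
    by (intro M.a_closed M.a_inv_closed)
  moreover have "a \<otimes> b \<oplus> \<ominus> (a \<otimes> b \<ominus> \<one>) = \<one>"
    using a b(1) by algebra
  ultimately show False
    using M.one_imp_carrier \<open>M \<noteq> carrier R\<close> by simp
qed

lemma (in cring) unit_zero_divisor_graph_quotient_adjacent:
  assumes fin: "finite (carrier R)"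
    and xy: "x \<in> carrier R" "y \<in> carrier R"
    and adj: "x \<rightarrow>\<^bsub>unit_zero_divisor_graph R\<^esub> y"
  shows "(jacobson_radical R +> x)
           \<rightarrow>\<^bsub>unit_zero_divisor_graph (R Quot jacobson_radical R)\<^esub>
         (jacobson_radical R +> y)"
proof -
  define J where "J = jacobson_radical R"
  interpret J: ideal J R
    unfolding J_def using is_cring by (rule ideal_jacobson_radical)
  interpret Q: cring "R Quot J"
    using is_cring by (rule J.quotient_is_cring)
  interpret h: ring_hom_ring R "R Quot J" "(+>) J"
    by (rule J.rcos_ring_hom_ring)
  have "x \<noteq> y" and sum: "x \<oplus> y \<in> Units R" and prod: "x \<otimes> y \<in> zero_divisors R"
    using adj by (auto simp: unit_zero_divisor_graph_def)
  \<comment> \<open>The zero ring has no two distinct elements.\<close>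
  have "\<one> \<noteq> \<zero>"
    using \<open>x \<noteq> y\<close> xy one_zeroD by auto
  then have "x \<otimes> y \<notin> Units R"
    using prod by (rule zero_divisors_not_Units)
  then obtain M where M: "maximalideal M R" and "x \<otimes> y \<in> M"
    using finite_not_Units_maximalideal[OF fin m_closed[OF xy]] by blast
  interpret M: maximalideal M R by fact
  interpret M: primeideal M R
    using M by (rule maximalideal_prime)
  have JM: "J \<subseteq> M"
    unfolding J_def using M by (rule jacobson_radical_subset_maximalideal)
  have "J +> x \<noteq> J +> y"
  proof
    assume "J +> x = J +> y"
    then have d: "x \<ominus> y \<in> M"
      using quotient_eq_iff_same_a_r_cos[OF J.is_ideal xy] JM by auto
    have "x \<in> M \<or> y \<in> M"
      using xy \<open>x \<otimes> y \<in> M\<close> by (rule M.I_prime)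
    then have "x \<oplus> y \<in> M"
    proof
      assume "x \<in> M"
      \<comment> \<open>Here \<open>y\<close> is written as \<open>x\<close> minus the element
        \<open>x \<ominus> y\<close> of \<open>M\<close>; the other case writes \<open>x\<close> as
        \<open>(x \<ominus> y) \<oplus> y\<close>.\<close>
      then have "x \<oplus> (x \<oplus> \<ominus> (x \<ominus> y)) \<in> M"
        using d by (intro M.a_closed M.a_inv_closed)
      also have "x \<oplus> (x \<oplus> \<ominus> (x \<ominus> y)) = x \<oplus> y"
        using xy by algebra
      finally show ?thesis .
    next
      assume "y \<in> M"
      then have "(x \<ominus> y) \<oplus> y \<oplus> y \<in> M"
        using d by (intro M.a_closed)
      also have "(x \<ominus> y) \<oplus> y \<oplus> y = x \<oplus> y"
        using xy by algebra
      finally show ?thesis .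
    qed
    \<comment> \<open>The product is \<open>\<one>\<close>, which a proper ideal cannot
      contain.\<close>
    then have "(x \<oplus> y) \<otimes> inv (x \<oplus> y) \<in> M"
      using sum by (intro M.I_r_closed) auto
    then show False
      using sum M.I_notcarr M.one_imp_carrier by simp
  qed
  moreover have "(J +> x) \<oplus>\<^bsub>R Quot J\<^esub> (J +> y) \<in> Units (R Quot J)"
    using h.hom_Units[OF sum] h.hom_add[OF xy] by argo
  moreover have "(J +> x) \<otimes>\<^bsub>R Quot J\<^esub> (J +> y) \<in> zero_divisors (R Quot J)"
  proof (rule Q.finite_not_Units_zero_divisors)
    \<comment> \<open>As an image of \<open>R\<close> the quotient is finite, so there too every
      non-unit is a zero divisor.\<close>
    have "carrier (R Quot J) = (+>) J ` carrier R"
      unfolding FactRing_def A_RCOSETS_def' by auto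
    then show "finite (carrier (R Quot J))"
      using fin by (metis finite_imageI)
    have "J +> x \<otimes> y \<notin> Units (R Quot J)"
      using rcos_Units_imp_not_mem_ideal[OF J.is_ideal M.is_ideal JM M.I_notcarr[symmetric]]
        \<open>x \<otimes> y \<in> M\<close> xy by blast
    then show "(J +> x) \<otimes>\<^bsub>R Quot J\<^esub> (J +> y) \<notin> Units (R Quot J)"
      using h.hom_mult[OF xy] by argo
  qed (intro Q.m_closed h.hom_closed xy)
  ultimately show ?thesis
    using h.hom_closed xy by (simp add: unit_zero_divisor_graph_def J_def[symmetric])
qed

theorem theorem3p17:
  fixes R :: "('a, 'm) ring_scheme"
  assumes "cring R"
    and "finite (carrier R)"
    and "x \<in> carrier R"
    and "y \<in> carrier R"
    and "x \<rightarrow>\<^bsub>unit_zero_divisor_graph R\<^esub> y"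
  shows "(jacobson_radical R +>\<^bsub>R\<^esub> x)
           \<rightarrow>\<^bsub>unit_zero_divisor_graph (R Quot jacobson_radical R)\<^esub>
         (jacobson_radical R +>\<^bsub>R\<^esub> y)"
  using assms by (rule cring.unit_zero_divisor_graph_quotient_adjacent)

end
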